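(* Let $n_1,\ldots,n_t$ be positive integers, let $t_e$ and $t_o$ be respectively the number of even and odd integers in the sequence $(n_1,\ldots,n_t)$, and let $f=82\times 35^{2^{t_o}-2}\times 81^{t_e}$. Let $c=\min\{95412,f\}$ if $t=2$ and $c=f$ otherwise. Suppose that $n=\max\{n_1,\ldots,n_t\}$ and that for each $1\leq i\leq t$ we have $n_i\geq 2\lceil \log (nc) \rceil+2$. Then, for sufficiently large $n$, $$\hat{R}(C_{n_1},\ldots,C_{n_t})\leq (\ln c+1)\,c^2\, n.$$
   Context: $C_k$ denotes the cycle on $k$ vertices. For graphs $G_1,\ldots,G_k$, the size-Ramsey number $\hat{R}(G_1,\ldots,G_k)$ is the smallest integer $m$ for which there exists a graph $H$ with $m$ edges such that for every coloring of the edges of $H$ with colors $1,\ldots,k$ there is, for some $i$, a copy of $G_i$ in $H$ all of whose edges have color $i$. $\log$ denotes the logarithm to base $2$ and $\ln$ the natural logarithm. *)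

theory Defs
  imports Complex_Main
begin

definition simple_graph :: "nat set set \<Rightarrow> bool" where
  "simple_graph E \<longleftrightarrow> finite E \<and> (\<forall>e\<in>E. card e = 2)"

definition has_mono_cycle :: "nat set set \<Rightarrow> (nat set \<Rightarrow> nat) \<Rightarrow> nat \<Rightarrow> nat \<Rightarrow> bool" where
  "has_mono_cycle E col i k \<longleftrightarrow>
     (\<exists>v :: nat \<Rightarrow> nat. inj_on v {..<k} \<and>
        (\<forall>j<k. {v j, v ((j + 1) mod k)} \<in> E \<and> col {v j, v ((j + 1) mod k)} = i))"

definition arrows_cycles :: "nat set set \<Rightarrow> nat list \<Rightarrow> bool" where
  "arrows_cycles E ns \<longleftrightarrow>
     (\<forall>col. (\<forall>e\<in>E. col e < length ns) \<longrightarrow>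
        (\<exists>i<length ns. has_mono_cycle E col i (ns ! i)))"

definition size_ramsey_cycles :: "nat list \<Rightarrow> nat" where
  "size_ramsey_cycles ns =
     (LEAST m. \<exists>E. simple_graph E \<and> card E = m \<and> arrows_cycles E ns)"

definition num_even :: "nat list \<Rightarrow> nat" where
  "num_even ns = length (filter even ns)"

definition num_odd :: "nat list \<Rightarrow> nat" where
  "num_odd ns = length (filter odd ns)"

definition f_const :: "nat list \<Rightarrow> real" where
  "f_const ns = 82 * 35 powr (2 ^ num_odd ns - 2) * 81 ^ num_even ns"

definition c_const :: "nat list \<Rightarrow> real" where
  "c_const ns = (if length ns = 2 then min 95412 (f_const ns) else f_const ns)"

end

theory Submission
  imports Defs
begin

text \<open>
  Take a graph on \<open>b n\<close> vertices, \<open>b < c\<close>, with an edge between any two disjoint sets of \<open>n\<close>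
  vertices; a random graph with \<open>(ln c + 1) c\<^sup>2 n\<close> edges has this property. Call a pair \<open>A, B\<close> of
  disjoint sets \<open>m\<close>-joined in a colour if every two subsets of \<open>A\<close> and \<open>B\<close> of size \<open>m\<close> are linked
  by an edge of that colour. If the pair is large compared to \<open>m\<close>, it contains cycles of all even
  lengths between \<open>2 log m + O(1)\<close> and \<open>m\<close>: depth-first search gives a long path, and its two
  ends are connected by growing binary trees of a fixed depth in a reserved expanding part. In the
  same way, an edge of that colour inside all but \<open>O(m)\<close> vertices of \<open>A\<close> closes an odd cycle of
  every such length.

  Hence, in the absence of the required cycles, each odd colour can be avoided between two large
  sets: either it is not joined, or it is nearly absent inside \<open>A\<close>, where one recurses on the
  other odd colours; this roughly squares the ratio \<open>b\<close>. Between these sets each even colour is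
  not joined and is removed at the cost of a factor 81. Finally there are two disjoint sets of
  size \<open>n\<close> with no edge at all between them, a contradiction.
\<close>

section \<open>Joined pairs and trees in expanding pairs\<close>

definition nbrs :: "('a \<Rightarrow> 'a \<Rightarrow> bool) \<Rightarrow> 'a set \<Rightarrow> 'a set \<Rightarrow> 'a set" where
  "nbrs R S T = {y \<in> T. \<exists>x\<in>S. R x y}"

definition joined :: "('a \<Rightarrow> 'a \<Rightarrow> bool) \<Rightarrow> nat \<Rightarrow> 'a set \<Rightarrow> 'a set \<Rightarrow> bool" where
  "joined R m A B \<longleftrightarrow>
     (\<forall>X Y. X \<subseteq> A \<and> Y \<subseteq> B \<and> card X = m \<and> card Y = m \<longrightarrow> (\<exists>x\<in>X. \<exists>y\<in>Y. R x y))"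

text \<open>Lists let cycles be assembled by appending and reversing paths. Lengths below 3 would be
  degenerate; only lengths from 4 on occur.\<close>

definition has_cycle :: "('a \<Rightarrow> 'a \<Rightarrow> bool) \<Rightarrow> nat \<Rightarrow> bool" where
  "has_cycle R k \<longleftrightarrow>
     (\<exists>xs. length xs = k \<and> distinct xs \<and> successively R xs \<and> R (last xs) (hd xs))"

lemma joinedE:
  assumes "joined R m A B" "X \<subseteq> A" "Y \<subseteq> B" "m \<le> card X" "m \<le> card Y"
  obtains x y where "x \<in> X" "y \<in> Y" "R x y"
proof -
  obtain X' where "X' \<subseteq> X" "card X' = m" using assms(4) by (meson obtain_subset_with_card_n)
  moreover obtain Y' where "Y' \<subseteq> Y" "card Y' = m"
    using assms(5) by (meson obtain_subset_with_card_n)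
  ultimately have "\<exists>x\<in>X'. \<exists>y\<in>Y'. R x y"
    using assms(1-3) unfolding joined_def by (metis order_trans)
  then show ?thesis using \<open>X' \<subseteq> X\<close> \<open>Y' \<subseteq> Y\<close> that by blast
qed

lemma not_joinedE:
  assumes "\<not> joined R m A B"
  obtains X Y where "X \<subseteq> A" "Y \<subseteq> B" "card X = m" "card Y = m" "\<forall>x\<in>X. \<forall>y\<in>Y. \<not> R x y"
  using assms unfolding joined_def by auto

lemma joined_swap: "joined R m A B \<Longrightarrow> symp R \<Longrightarrow> joined R m B A"
  using joinedE[of R m A B] unfolding joined_def[of R m B A] by (metis le_refl sympD)

lemma joined_mono: "joined R m A B \<Longrightarrow> A' \<subseteq> A \<Longrightarrow> B' \<subseteq> B \<Longrightarrow> joined R m A' B'"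
  unfolding joined_def by (metis order_trans)

text \<open>The vertices of \<open>T\<close> that \<open>S\<close> does not see have no edge to
  \<open>S\<close>, so \<open>m\<close> of them would contradict joinedness.\<close>

lemma card_non_nbrs_less:
  assumes "joined R m A B" "S \<subseteq> A" "T \<subseteq> B" "finite B" "m \<le> card S" "0 < m"
  shows "card T < card (nbrs R S T) + m"
proof (rule ccontr)
  assume neg: "\<not> ?thesis"
  have fin: "finite T" using assms by (meson finite_subset)
  have "nbrs R S T \<subseteq> T" by (auto simp: nbrs_def)
  then have "card (T - nbrs R S T) = card T - card (nbrs R S T)"
    using fin by (meson card_Diff_subset finite_subset)
  then have "m \<le> card (T - nbrs R S T)" using neg by linarith
  then obtain x y where "x \<in> S" "y \<in> T - nbrs R S T" "R x y"
    using joinedE[OF assms(1,2)] assms(3,5) by (metis Diff_subset subset_trans)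
  then show False by (auto simp: nbrs_def)
qed

text \<open>A maximal pair of badly expanding sets \<^term>\<open>X\<close>, \<^term>\<open>Y\<close> is small because a large set
  sees almost everything; what remains after deleting it has no badly expanding set of size at
  most \<^term>\<open>m\<close>.\<close>

definition bad_pair :: "('a \<Rightarrow> 'a \<Rightarrow> bool) \<Rightarrow> nat \<Rightarrow> 'a set \<Rightarrow> 'a set \<Rightarrow> 'a set \<Rightarrow> 'a set \<Rightarrow> bool" where
  "bad_pair R m A B X Y \<longleftrightarrow> X \<subseteq> A \<and> Y \<subseteq> B \<and> card X \<le> 2 * m \<and> card Y \<le> 2 * m \<and>
     card (nbrs R X (B - Y)) \<le> 4 * card X \<and> card (nbrs R Y (A - X)) \<le> 4 * card Y"

lemma bad_pair_small:
  assumes "bad_pair R m A B X Y" "joined R m A B" "finite B" "11 * m \<le> card B" "0 < m"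
  shows "card X < m"
proof (rule ccontr)
  assume "\<not> card X < m"
  then have "card (B - Y) < card (nbrs R X (B - Y)) + m"
    using assms card_non_nbrs_less[of R m A B X "B - Y"] unfolding bad_pair_def by auto
  moreover have "card (B - Y) \<ge> card B - card Y" by (simp add: diff_card_le_card_Diff assms
        finite_subset[of Y B] bad_pair_def[THEN iffD1, OF assms(1)])
  \<comment> \<open>This is where 11 comes from: \<open>X\<close> sees more than
    \<open>11m - 2m - m = 8m\<close> vertices of \<open>B - Y\<close>, while badness allows at most
    \<open>4 * card X\<close>, that is, at most \<open>8m\<close>.\<close>
  ultimately show False using assms unfolding bad_pair_def by linarith
qed

lemma maximal_bad_pair_expands:
  assumes bad: "bad_pair R m A B X Y" and small: "card X < m"
    and fin: "finite A" "finite B"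
    and max: "\<And>X' Y'. bad_pair R m A B X' Y' \<Longrightarrow> card X' + card Y' \<le> card X + card Y"
    and S: "S \<subseteq> A - X" "card S \<le> m"
  shows "4 * card S \<le> card (nbrs R S (B - Y))"
proof (rule ccontr)
  assume neg: "\<not> ?thesis"
  have finS: "finite S" "finite X"
    using S bad fin unfolding bad_pair_def by (auto intro: finite_subset)
  have cU: "card (X \<union> S) = card X + card S" using S finS by (intro card_Un_disjoint) auto
  have "nbrs R (X \<union> S) (B - Y) = nbrs R X (B - Y) \<union> nbrs R S (B - Y)"
    by (auto simp: nbrs_def)
  then have "card (nbrs R (X \<union> S) (B - Y)) \<le> card (nbrs R X (B - Y)) + card (nbrs R S (B - Y))"
    by (metis card_Un_le)
  moreover have "card (nbrs R Y (A - (X \<union> S))) \<le> card (nbrs R Y (A - X))"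
    using fin by (intro card_mono) (auto simp: nbrs_def)
  \<comment> \<open>The size limit \<open>2 * m\<close> leaves room for \<open>S\<close>, since
    \<open>card X < m\<close> and \<open>card S\<close> is at most \<open>m\<close>. Enlarging
    \<open>X\<close> only removes neighbours of \<open>Y\<close>, so the condition on
    \<open>Y\<close> survives.\<close>
  ultimately have "bad_pair R m A B (X \<union> S) Y"
    using bad small S neg cU unfolding bad_pair_def by auto
  from max[OF this] cU neg show False by simp
qed

lemma bad_pair_swap: "bad_pair R m A B X Y \<Longrightarrow> bad_pair R m B A Y X"
  by (auto simp: bad_pair_def)

definition expanding :: "('a \<Rightarrow> 'a \<Rightarrow> bool) \<Rightarrow> nat \<Rightarrow> 'a set \<Rightarrow> 'a set \<Rightarrow> bool" where
  "expanding R m A B \<longleftrightarrow> (\<forall>S\<subseteq>A. card S \<le> m \<longrightarrow> 4 * card S \<le> card (nbrs R S B))"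

lemma expandingD:
  "expanding R m A B \<Longrightarrow> S \<subseteq> A \<Longrightarrow> card S \<le> m \<Longrightarrow> 4 * card S \<le> card (nbrs R S B)"
  by (simp add: expanding_def)

lemma joined_imp_expanding:
  assumes "joined R m A B" "symp R" "finite A" "finite B" "0 < m"
    "11 * m \<le> card A" "11 * m \<le> card B"
  obtains A' B' where "A' \<subseteq> A" "B' \<subseteq> B" "m \<le> card A'" "m \<le> card B'"
    "expanding R m A' B'" "expanding R m B' A'"
proof -
  let ?P = "\<lambda>p. bad_pair R m A B (fst p) (snd p)"
  have "?P ({}, {})" by (auto simp: bad_pair_def nbrs_def)
  moreover have "\<forall>p. ?P p \<longrightarrow> card (fst p) + card (snd p) < Suc (4 * m)"
    by (auto simp: bad_pair_def)
  ultimately have "\<exists>p. ?P p \<and> (\<forall>q. ?P q \<longrightarrow> card (fst q) + card (snd q) \<le> card (fst p) + card (snd p))"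
    by (rule ex_has_greatest_nat)
  then obtain p where p: "?P p"
    and pm: "\<And>q. ?P q \<Longrightarrow> card (fst q) + card (snd q) \<le> card (fst p) + card (snd p)"
    by blast
  define X Y where "X = fst p" and "Y = snd p"
  have bad: "bad_pair R m A B X Y" using p by (simp add: X_def Y_def)
  have max: "card X' + card Y' \<le> card X + card Y" if "bad_pair R m A B X' Y'" for X' Y'
    using pm[of "(X', Y')"] that by (simp add: X_def Y_def)
  have X: "card X < m" using bad_pair_small[OF bad] assms by auto
  have Y: "card Y < m"
    using bad_pair_small[OF bad_pair_swap[OF bad]] joined_swap assms by blast
  have sub: "X \<subseteq> A" "Y \<subseteq> B" using bad by (auto simp: bad_pair_def)
  show ?thesis
  proof (rule that[of "A - X" "B - Y"])
    show "m \<le> card (A - X)" "m \<le> card (B - Y)"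
      using X Y assms sub by (simp_all add: card_Diff_subset finite_subset)
    show "expanding R m (A - X) (B - Y)"
      using maximal_bad_pair_expands[OF bad X] assms max unfolding expanding_def by blast
    have "card X' + card Y' \<le> card Y + card X" if "bad_pair R m B A X' Y'" for X' Y'
      using max[OF bad_pair_swap[OF that]] by simp
    then show "expanding R m (B - Y) (A - X)"
      using maximal_bad_pair_expands[OF bad_pair_swap[OF bad] Y] assms
      unfolding expanding_def by blast
  qed auto
qed

definition side :: "nat \<Rightarrow> 'a set \<Rightarrow> 'a set \<Rightarrow> 'a set" where
  "side i A B = (if even i then A else B)"

text \<open>The layers have size exactly \<^term>\<open>(2::nat) ^ i\<close> whatever the root is, so that the depth needed
  to reach \<^term>\<open>m\<close> leaves does not depend on the root; this is what yields cycles of a prescribed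
  length.\<close>

lemma expanding_tree:
  assumes "expanding R m A B" "expanding R m B A" "finite A" "finite B" "a \<in> A"
    "i = 0 \<or> 2 ^ (i - 1) \<le> m"
  shows "\<exists>S Q. S \<subseteq> side i A B \<and> Q \<subseteq> A \<union> B \<and> card S = 2 ^ i \<and> card Q < 2 ^ (i + 1) \<and>
           (\<forall>s\<in>S. \<exists>xs. hd xs = a \<and> last xs = s \<and> length xs = Suc i \<and> successively R xs \<and>
              distinct xs \<and> set xs \<subseteq> Q)"
  using assms(6)
proof (induction i)
  case 0
  have "hd [a] = a \<and> last [a] = a \<and> length [a] = Suc 0 \<and> successively R [a] \<and>
      distinct [a] \<and> set [a] \<subseteq> {a}" by simp
  then have "\<forall>s\<in>{a}. \<exists>xs. hd xs = a \<and> last xs = s \<and> length xs = Suc 0 \<and> successively R xs \<and>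
      distinct xs \<and> set xs \<subseteq> {a}" by blast
  moreover have "{a} \<subseteq> side 0 A B \<and> {a} \<subseteq> A \<union> B \<and> card {a} = 2 ^ 0 \<and> card {a} < 2 ^ (0 + 1)"
    using assms(5) by (simp add: side_def)
  ultimately show ?case by blast
next
  case (Suc i)
  have im: "2 ^ i \<le> m" using Suc.prems by simp
  have "i = 0 \<or> 2 ^ (i - 1) \<le> m"
    using im by (meson diff_le_self le_trans one_le_numeral power_increasing)
  from Suc.IH[OF this] obtain S Q where S: "S \<subseteq> side i A B" "card S = 2 ^ i"
    and Q: "Q \<subseteq> A \<union> B" "card Q < 2 ^ (i + 1)"
    and paths: "\<And>s. s \<in> S \<Longrightarrow> \<exists>xs. hd xs = a \<and> last xs = s \<and> length xs = Suc i \<and>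
        successively R xs \<and> distinct xs \<and> set xs \<subseteq> Q"
    by blast
  let ?N = "nbrs R S (side (Suc i) A B)"
  have "4 * card S \<le> card ?N"
    using expandingD[OF assms(1), of S] expandingD[OF assms(2), of S] S im
    by (cases "even i") (simp_all add: side_def)
  moreover have finQ: "finite Q" using Q assms by (meson finite_UnI finite_subset)
  then have "card ?N - card Q \<le> card (?N - Q)" by (rule diff_card_le_card_Diff)
  \<comment> \<open>Expansion by 4 gives \<open>4 * 2 ^ i\<close> neighbours; fewer than
    \<open>2 ^ (i + 1)\<close> vertices are already used, so a doubled new layer remains.\<close>
  ultimately have "2 ^ Suc i \<le> card (?N - Q)" using S(2) Q(2) by simp
  then obtain S' where S': "S' \<subseteq> ?N - Q" "card S' = 2 ^ Suc i"
    by (meson obtain_subset_with_card_n)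
  show ?case
  proof (rule exI[of _ S'], rule exI[of _ "Q \<union> S'"], intro conjI ballI)
    show sub: "S' \<subseteq> side (Suc i) A B" using S'(1) by (auto simp: nbrs_def)
    show "Q \<union> S' \<subseteq> A \<union> B" using sub Q(1) by (auto simp: side_def split: if_splits)
    show "card S' = 2 ^ Suc i" by fact
    show "card (Q \<union> S') < 2 ^ (Suc i + 1)" using card_Un_le[of Q S'] Q(2) S'(2) by simp
    fix y assume "y \<in> S'"
    then have "y \<in> ?N" "y \<notin> Q" using S'(1) by auto
    then obtain s where s: "s \<in> S" "R s y" by (auto simp: nbrs_def)
    from paths[OF s(1)] obtain xs where xs: "hd xs = a" "last xs = s" "length xs = Suc i"
      "successively R xs" "distinct xs" "set xs \<subseteq> Q" by blast
    have "xs \<noteq> []" using xs(3) by auto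
    then show "\<exists>xs. hd xs = a \<and> last xs = y \<and> length xs = Suc (Suc i) \<and> successively R xs \<and>
              distinct xs \<and> set xs \<subseteq> Q \<union> S'"
      using xs s(2) \<open>y \<notin> Q\<close> \<open>y \<in> S'\<close>
      by (intro exI[of _ "xs @ [y]"]) (auto simp: successively_append_iff)
  qed
qed

lemma successively_rev_sym: "symp R \<Longrightarrow> successively R (rev xs) \<longleftrightarrow> successively R xs"
  unfolding successively_rev by (intro iffI; erule successively_mono) (auto simp: symp_def)

text \<open>The least exponent works. The last alternative is the size condition of
  \<open>expanding_tree\<close> at depth \<open>d\<close>: the layer before the leaves still has at
  most \<open>m\<close> vertices.\<close>

lemma exists_binary_depth:
  assumes "0 < (m::nat)" "m \<le> 2 ^ D"
  obtains d where "d \<le> D" "m \<le> 2 ^ d" "d = 0 \<or> 2 ^ (d - 1) \<le> m"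
proof -
  define d where "d = (LEAST d. m \<le> 2 ^ d)"
  have "m \<le> 2 ^ d" "d \<le> D" unfolding d_def using assms(2) by (auto intro: LeastI Least_le)
  moreover have "d = 0 \<or> 2 ^ (d - 1) \<le> m"
  proof (cases d)
    case (Suc k)
    then have "\<not> m \<le> 2 ^ k" unfolding d_def using not_less_Least[of k "\<lambda>d. m \<le> 2 ^ d"] by auto
    then show ?thesis using Suc by simp
  qed simp
  ultimately show ?thesis using that by blast
qed

text \<open>All pairs of vertices outside a small set are linked through the reserve \<^term>\<open>T\<close> by paths of
  one and the same length: a tree is grown in the reserve from a neighbour of each of the two
  vertices, and two leaves are adjacent.\<close>

lemma joined_linked:
  assumes J: "joined R m A B" and sym: "symp R" and fin: "finite A" "finite B"
    and dis: "A \<inter> B = {}" and m: "0 < m" "m \<le> 2 ^ D"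
    and cA: "22 * m \<le> card A" and cB: "22 * m \<le> card B"
  obtains d GA GB T where "d \<le> D" "GA \<subseteq> A - T" "GB \<subseteq> B - T"
    "card A \<le> card GA + 23 * m" "card B \<le> card GB + 23 * m"
    "\<And>x z. x \<in> GA \<Longrightarrow> z \<in> GB \<Longrightarrow> \<exists>xs. length xs = 2 * d + 2 \<and> distinct xs \<and> set xs \<subseteq> T \<and>
       successively R (x # xs @ [z])"
proof -
  obtain d where d: "d \<le> D" "m \<le> 2 ^ d" "d = 0 \<or> 2 ^ (d - 1) \<le> m"
    using exists_binary_depth[OF m] by blast
  \<comment> \<open>Two disjoint reserves, with \<open>11 * m\<close> vertices on each side, keep
    the trees grown for the two ends of a link apart.\<close>
  obtain A1 where A1: "A1 \<subseteq> A" "card A1 = 11 * m"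
    using cA obtain_subset_with_card_n[of "11 * m" A] by auto
  have "11 * m \<le> card (A - A1)" using A1 cA fin by (simp add: card_Diff_subset finite_subset)
  then obtain A2 where A2: "A2 \<subseteq> A - A1" "card A2 = 11 * m"
    using obtain_subset_with_card_n[of "11 * m" "A - A1"] by auto
  obtain B1 where B1: "B1 \<subseteq> B" "card B1 = 11 * m"
    using cB obtain_subset_with_card_n[of "11 * m" B] by auto
  have "11 * m \<le> card (B - B1)" using B1 cB fin by (simp add: card_Diff_subset finite_subset)
  then obtain B2 where B2: "B2 \<subseteq> B - B1" "card B2 = 11 * m"
    using obtain_subset_with_card_n[of "11 * m" "B - B1"] by auto
  have fins: "finite A1" "finite A2" "finite B1" "finite B2"
    using fin A1 A2 B1 B2 by (meson finite_Diff finite_subset)+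
  have "joined R m A1 B1" "joined R m A2 B2"
    using joined_mono[OF J] A1 A2 B1 B2 by (meson Diff_subset subset_trans)+
  note J12 = this
  obtain A1' B1' where s1: "A1' \<subseteq> A1" "B1' \<subseteq> B1" "m \<le> card A1'" "m \<le> card B1'"
     and e1: "expanding R m A1' B1'" "expanding R m B1' A1'"
    by (rule joined_imp_expanding[OF J12(1) sym fins(1,3) m(1)]) (simp_all add: A1 B1)
  obtain A2' B2' where s2: "A2' \<subseteq> A2" "B2' \<subseteq> B2" "m \<le> card A2'" "m \<le> card B2'"
     and e2: "expanding R m A2' B2'" "expanding R m B2' A2'"
    by (rule joined_imp_expanding[OF J12(2) sym fins(2,4) m(1)]) (simp_all add: A2 B2)
  have fins': "finite A1'" "finite A2'" "finite B1'" "finite B2'"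
    using fins s1 s2 by (meson finite_subset)+
  define T where "T = A1 \<union> A2 \<union> B1 \<union> B2"
  \<comment> \<open>These are the vertices that can enter the reserve. Since \<open>B1'\<close> and
    \<open>A2'\<close> have at least \<open>m\<close> vertices, fewer than \<open>m\<close> are lost
    on each side beyond the \<open>22 * m\<close> of the reserve; hence 23.\<close>
  define GA GB where "GA = nbrs R B1' (A - T)" and "GB = nbrs R A2' (B - T)"
  have TA: "card A \<le> card (A - T) + 22 * m"
  proof -
    have "A - T = A - (A1 \<union> A2)" using B1 B2 dis unfolding T_def by auto
    moreover have "card (A1 \<union> A2) \<le> 22 * m" using card_Un_le[of A1 A2] A1 A2 by simp
    moreover have "card A - card (A1 \<union> A2) \<le> card (A - (A1 \<union> A2))"
      using fins by (intro diff_card_le_card_Diff) auto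
    ultimately show ?thesis by simp
  qed
  have TB: "card B \<le> card (B - T) + 22 * m"
  proof -
    have "B - T = B - (B1 \<union> B2)" using A1 A2 dis unfolding T_def by auto
    moreover have "card (B1 \<union> B2) \<le> 22 * m" using card_Un_le[of B1 B2] B1 B2 by simp
    moreover have "card B - card (B1 \<union> B2) \<le> card (B - (B1 \<union> B2))"
      using fins by (intro diff_card_le_card_Diff) auto
    ultimately show ?thesis by simp
  qed
  have "card (A - T) < card GA + m" unfolding GA_def
    using card_non_nbrs_less[OF joined_swap[OF J sym], of B1' "A - T"] s1 B1 fin m by auto
  moreover have "card (B - T) < card GB + m" unfolding GB_def
    using card_non_nbrs_less[OF J, of A2' "B - T"] s2 A2 fin m by auto
  moreover have "\<exists>xs. length xs = 2 * d + 2 \<and> distinct xs \<and> set xs \<subseteq> T \<and>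
       successively R (x # xs @ [z])" if xz: "x \<in> GA" "z \<in> GB" for x z
  proof -
    obtain b where b: "b \<in> B1'" "R x b" using xz(1) sym unfolding GA_def nbrs_def symp_def by auto
    obtain a where a: "a \<in> A2'" "R a z" using xz(2) unfolding GB_def nbrs_def by auto
    obtain S Q where S: "S \<subseteq> side d B1' A1'" "Q \<subseteq> B1' \<union> A1'" "card S = 2 ^ d"
      and Sp: "\<And>s. s \<in> S \<Longrightarrow> \<exists>xs. hd xs = b \<and> last xs = s \<and> length xs = Suc d \<and> successively R xs \<and>
              distinct xs \<and> set xs \<subseteq> Q"
      using expanding_tree[OF e1(2,1) _ _ b(1) d(3)] fins' by blast
    obtain S' Q' where S': "S' \<subseteq> side d A2' B2'" "Q' \<subseteq> A2' \<union> B2'" "card S' = 2 ^ d"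
      and Sp': "\<And>s. s \<in> S' \<Longrightarrow> \<exists>xs. hd xs = a \<and> last xs = s \<and> length xs = Suc d \<and> successively R xs \<and>
              distinct xs \<and> set xs \<subseteq> Q'"
      using expanding_tree[OF e2 _ _ a(1) d(3)] fins' by blast
    \<comment> \<open>The trees are rooted on opposite sides, so at equal depth their leaves also
      lie on opposite sides, at least \<open>m\<close> on each.\<close>
    have "\<exists>s\<in>S. \<exists>s'\<in>S'. R s s'"
    proof (cases "even d")
      case True
      then have "S \<subseteq> B" "S' \<subseteq> A"
        using S(1) S'(1) s1 s2 A1 A2 B1 B2 unfolding side_def by auto
      then show ?thesis using joinedE[OF joined_swap[OF J sym], of S S'] S(3) S'(3) d(2) by metis
    next
      case False
      then have "S \<subseteq> A" "S' \<subseteq> B"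
        using S(1) S'(1) s1 s2 A1 A2 B1 B2 unfolding side_def by auto
      then show ?thesis using joinedE[OF J, of S S'] S(3) S'(3) d(2) by metis
    qed
    then obtain s s' where s: "s \<in> S" "s' \<in> S'" "R s s'" by blast
    obtain p where p: "hd p = b" "last p = s" "length p = Suc d" "successively R p"
       "distinct p" "set p \<subseteq> Q" using Sp[OF s(1)] by blast
    obtain p' where p': "hd p' = a" "last p' = s'" "length p' = Suc d" "successively R p'"
       "distinct p'" "set p' \<subseteq> Q'" using Sp'[OF s(2)] by blast
    have ne: "p \<noteq> []" "p' \<noteq> []" using p(3) p'(3) by auto
    have disj: "(B1' \<union> A1') \<inter> (A2' \<union> B2') = {}"
      using dis s1 s2 A1 A2 B1 B2 by blast
    have "successively R (p @ rev p')"
      using p p' s(3) ne successively_rev_sym[OF sym, of p']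
      by (auto simp: successively_append_iff hd_rev)
    then have "successively R (x # (p @ rev p') @ [z])"
      using ne p p' a b by (auto simp: successively_append_iff successively_Cons last_rev)
    moreover have "set p \<inter> set p' = {}" using p(6) p'(6) S(2) S'(2) disj by blast
    then have "distinct (p @ rev p')" using p(5) p'(5) by simp
    moreover have "set (p @ rev p') \<subseteq> T"
      using p(6) p'(6) S(2) S'(2) s1 s2 unfolding T_def by auto
    moreover have "length (p @ rev p') = 2 * d + 2" using p(3) p'(3) by simp
    ultimately show ?thesis by blast
  qed
  moreover have "GA \<subseteq> A - T" "GB \<subseteq> B - T" unfolding GA_def GB_def nbrs_def by auto
  ultimately show ?thesis using that[of d GA T GB] d(1) TA TB by simp
qed

text \<open>Both paths run from \<open>hd ps\<close> to \<open>last ps\<close>; the interior of the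
  second, reversed, closes the first.\<close>

lemma has_cycleI:
  assumes "symp R" "ps \<noteq> []" "distinct ps" "successively R ps" "distinct xs" "xs \<noteq> []"
    "set ps \<inter> set xs = {}" "successively R (hd ps # xs @ [last ps])"
  shows "has_cycle R (length ps + length xs)"
proof -
  have x: "R (hd ps) (hd xs)" "R (last xs) (last ps)" "successively R xs"
    using assms(6,8) by (auto simp: successively_append_iff successively_Cons)
  have "successively R (ps @ rev xs)"
    using assms x successively_rev_sym[OF assms(1), of xs]
    by (auto simp: successively_append_iff hd_rev symp_def)
  moreover have "R (last (ps @ rev xs)) (hd (ps @ rev xs))"
    using assms x by (auto simp: last_rev symp_def)
  moreover have "distinct (ps @ rev xs)" "length (ps @ rev xs) = length ps + length xs"
    using assms by auto
  ultimately show ?thesis unfolding has_cycle_def by blast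
qed

section \<open>Long paths\<close>

text \<open>Depth-first search: \<^term>\<open>P\<close> is the stack, \<^term>\<open>D\<close> and \<^term>\<open>U\<close> are the finished and the unvisited
  vertices. Every step decreases the size of \<^term>\<open>U\<close> minus that of \<^term>\<open>D\<close> by exactly one, so at
  \<^term>\<open>j = card V\<close> the two sets have equal size.\<close>

lemma dfs_state:
  assumes "finite V" "symp R" "j \<le> card V"
  shows "\<exists>D P U. V = D \<union> set P \<union> U \<and> D \<inter> set P = {} \<and> D \<inter> U = {} \<and> set P \<inter> U = {} \<and>
    distinct P \<and> successively R P \<and> (\<forall>x\<in>D. \<forall>y\<in>U. \<not> R x y) \<and> card U + j = card D + card V"
  using assms(3)
proof (induction j)
  case 0
  show ?case by (rule exI[of _ "{}"], rule exI[of _ "[]"], rule exI[of _ V]) auto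
next
  case (Suc j)
  then obtain D P U where st: "V = D \<union> set P \<union> U" "D \<inter> set P = {}" "D \<inter> U = {}" "set P \<inter> U = {}"
    "distinct P" "successively R P" "\<forall>x\<in>D. \<forall>y\<in>U. \<not> R x y" "card U + j = card D + card V"
    by auto
  have fin: "finite D" "finite U" using st(1) assms(1) by auto
  have "card U > 0" using st(8) Suc.prems by linarith
  then obtain u where u: "u \<in> U" by fastforce
  show ?case
  \<comment> \<open>Pop the top \<open>hd P\<close> when it has no unvisited neighbour, and push
    otherwise. Onto an empty stack any unvisited vertex may be pushed.\<close>
  proof (cases "P \<noteq> [] \<and> (\<forall>y\<in>U. \<not> R (hd P) y)")
    case True
    then obtain v P' where P: "P = v # P'" by (cases P) auto
    have "successively R P'" using st(6) P by (cases P') (auto simp: successively_Cons)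
    moreover have "v \<notin> D" using st(2) P by auto
    ultimately show ?thesis
      using st True P fin
      by (intro exI[of _ "insert v D"] exI[of _ P'] exI[of _ U]) auto
  next
    case False
    then obtain y where y: "y \<in> U" "P = [] \<or> R (hd P) y" using u by blast
    have "successively R (y # P)" using st(6) y(2) assms(2)
      by (auto simp: successively_Cons symp_def)
    moreover have "Suc (card (U - {y})) = card U" using y fin by (metis card_Suc_Diff1)
    moreover have "y \<notin> D" "y \<notin> set P" using y st by auto
    moreover have "V = D \<union> set (y # P) \<union> (U - {y})" using st(1) y(1) by auto
    moreover have "D \<inter> set (y # P) = {}" "D \<inter> (U - {y}) = {}" "set (y # P) \<inter> (U - {y}) = {}"
      "\<forall>x\<in>D. \<forall>z\<in>U - {y}. \<not> R x z"
      using st(2,3,4,7) \<open>y \<notin> D\<close> by auto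
    moreover have "distinct (y # P)" "card (U - {y}) + Suc j = card D + card V"
      using st(5,8) \<open>y \<notin> set P\<close> \<open>Suc (card (U - {y})) = card U\<close> by simp_all
    ultimately show ?thesis by blast
  qed
qed

text \<open>Discarding the edges inside either side makes paths alternate, so the parity of the
  length determines the side of the last vertex.\<close>

definition cross :: "('a \<Rightarrow> 'a \<Rightarrow> bool) \<Rightarrow> 'a set \<Rightarrow> 'a set \<Rightarrow> 'a \<Rightarrow> 'a \<Rightarrow> bool" where
  "cross R A B x y \<longleftrightarrow> R x y \<and> (x \<in> A \<and> y \<in> B \<or> x \<in> B \<and> y \<in> A)"

lemma cross_path_side:
  assumes "successively (cross R A B) xs" "hd xs \<in> A" "A \<inter> B = {}" "i < length xs"
  shows "xs ! i \<in> side i A B"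
  using assms(4)
proof (induction i)
  case 0
  then show ?case using assms(2) by (simp add: side_def hd_conv_nth)
next
  case (Suc i)
  then have "cross R A B (xs ! i) (xs ! Suc i)"
    using assms(1) by (simp add: successively_conv_nth)
  then show ?case using Suc assms(3) by (auto simp: cross_def side_def split: if_splits)
qed

text \<open>Later only a difference of at most one matters; saying that only the side of the first
  vertex can be ahead is what makes the induction go through.\<close>

lemma cross_path_balanced:
  assumes "successively (cross R A B) xs" "A \<inter> B = {}"
  shows "length (filter (\<lambda>x. x \<in> A) xs) \<le> length (filter (\<lambda>x. x \<in> B) xs) + (if xs \<noteq> [] \<and> hd xs \<in> A then 1 else 0)
    \<and> length (filter (\<lambda>x. x \<in> B) xs) \<le> length (filter (\<lambda>x. x \<in> A) xs) + (if xs \<noteq> [] \<and> hd xs \<in> B then 1 else 0)"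
  using assms
proof (induction xs)
  case (Cons x xs)
  then show ?case by (cases xs) (auto simp: cross_def split: if_splits)
qed simp

lemma joined_path:
  assumes J: "joined R m A B" and sym: "symp R" and fin: "finite A" "finite B"
    and dis: "A \<inter> B = {}" and m: "0 < m" and card: "3 * m \<le> card A" "3 * m \<le> card B"
    and r: "0 < r" "r < m"
  obtains xs where "length xs = r" "distinct xs" "successively R xs" "set xs \<subseteq> A \<union> B"
    "hd xs \<in> A" "last xs \<in> side (r - 1) A B"
proof -
  obtain A' where A': "A' \<subseteq> A" "card A' = 3 * m" using card obtain_subset_with_card_n by metis
  obtain B' where B': "B' \<subseteq> B" "card B' = 3 * m" using card obtain_subset_with_card_n by metis
  have fin': "finite A'" "finite B'" using A' B' fin by (meson finite_subset)+
  have dis': "A' \<inter> B' = {}" using A' B' dis by auto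
  let ?R = "cross R A' B'"
  have sym': "symp ?R" using sym unfolding cross_def symp_def by blast
  have cV: "card (A' \<union> B') = 6 * m" using card_Un_disjoint[OF fin' dis'] A' B' by simp
  obtain D P U where st: "A' \<union> B' = D \<union> set P \<union> U" "D \<inter> set P = {}" "D \<inter> U = {}" "set P \<inter> U = {}"
    "distinct P" "successively ?R P" "\<forall>x\<in>D. \<forall>y\<in>U. \<not> ?R x y"
    "card U + card (A' \<union> B') = card D + card (A' \<union> B')"
    using dfs_state[OF _ sym' order_refl, of "A' \<union> B'"] fin' by blast
  have fDU: "finite D" "finite U" using st(1) fin' by (metis finite_Un)+
  have split3: "card X = card (D \<inter> X) + card (set P \<inter> X) + card (U \<inter> X)"
    if "X \<subseteq> A' \<union> B'" for X
  proof -
    have "X = (D \<inter> X) \<union> (set P \<inter> X) \<union> (U \<inter> X)" using that st(1) by auto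
    moreover have "card ((D \<inter> X) \<union> (set P \<inter> X) \<union> (U \<inter> X)) =
        card (D \<inter> X) + card (set P \<inter> X) + card (U \<inter> X)"
      using st(2-4) fDU by (subst card_Un_disjoint; (subst card_Un_disjoint)?) auto
    ultimately show ?thesis by simp
  qed
  have split2: "card X = card (X \<inter> A') + card (X \<inter> B')" if "X \<subseteq> A' \<union> B'" for X
  proof -
    have "X = (X \<inter> A') \<union> (X \<inter> B')" using that by auto
    moreover have "card ((X \<inter> A') \<union> (X \<inter> B')) = card (X \<inter> A') + card (X \<inter> B')"
      using dis' fin' by (intro card_Un_disjoint) auto
    ultimately show ?thesis by simp
  qed
  have J': "joined R m A' B'" using joined_mono[OF J] A' B' by auto
  have c1: "card (D \<inter> A') < m \<or> card (U \<inter> B') < m"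
  proof (rule ccontr)
    assume "\<not> ?thesis"
    then obtain x y where "x \<in> D \<inter> A'" "y \<in> U \<inter> B'" "R x y"
      using joinedE[OF J', of "D \<inter> A'" "U \<inter> B'"] by auto
    then show False using st(7) by (auto simp: cross_def)
  qed
  have c2: "card (D \<inter> B') < m \<or> card (U \<inter> A') < m"
  proof (rule ccontr)
    assume "\<not> ?thesis"
    then obtain x y where "x \<in> U \<inter> A'" "y \<in> D \<inter> B'" "R x y"
      using joinedE[OF J', of "U \<inter> A'" "D \<inter> B'"] by auto
    then show False using st(7) sym by (auto simp: cross_def symp_def)
  qed
  have lf: "length (filter (\<lambda>x. x \<in> X) P) = card (set P \<inter> X)" for X
    using st(5) by (metis Int_commute distinct_card distinct_filter inter_set_filter)
  have bal: "card (set P \<inter> A') \<le> card (set P \<inter> B') + 1" "card (set P \<inter> B') \<le> card (set P \<inter> A') + 1"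
    using cross_path_balanced[OF st(6) dis'] unfolding lf by (auto split: if_splits)
  have "card (set P) = card (set P \<inter> A') + card (set P \<inter> B')"
    "card D = card (D \<inter> A') + card (D \<inter> B')" "card U = card (U \<inter> A') + card (U \<inter> B')"
    using split2 st(1) by auto
  moreover have "card D = card U" using st(8) by simp
  \<comment> \<open>Either one of \<open>D\<close>, \<open>U\<close> has fewer than \<open>m\<close>
    vertices on both sides, so both have fewer than \<open>2 * m\<close> of the \<open>6 * m\<close>
    vertices; or both have fewer than \<open>m\<close> on one common side, so \<open>P\<close> has
    more than \<open>m\<close> vertices there and, by balance, almost as many on the other.\<close>
  ultimately have "card (set P) \<ge> 2 * m - 1"
    using split3[of A'] split3[of B'] A' B' c1 c2 bal by auto
  then have len: "length P \<ge> Suc r" using r st(5) distinct_card[of P] by linarith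
  have PV: "set P \<subseteq> A' \<union> B'" using st(1) by auto
  \<comment> \<open>A path that starts in \<open>B'\<close> loses its first vertex; this is why
    \<open>Suc r\<close> vertices were secured.\<close>
  define Q where "Q = (if hd P \<in> A' then P else tl P)"
  obtain x y P' where P: "P = x # y # P'" using len r by (cases P; cases "tl P") auto
  have Q: "successively ?R Q" "distinct Q" "set Q \<subseteq> A' \<union> B'" "r \<le> length Q"
    using st(5,6) PV len unfolding Q_def P by auto
  have hdQ: "hd Q \<in> A'"
  proof (cases "hd P \<in> A'")
    case False
    then show ?thesis using P st(6) by (auto simp: Q_def cross_def)
  qed (simp add: Q_def)
  define xs where "xs = take r Q"
  have tk: "xs @ drop r Q = Q" by (simp add: xs_def)
  have lx: "length xs = r" using Q(4) by (simp add: xs_def)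
  then have ne: "xs \<noteq> []" using r by auto
  have sx: "successively ?R xs" using Q(1) tk by (metis successively_append_iff)
  have hx: "hd xs \<in> A'" using hdQ tk ne by (metis hd_append2)
  show ?thesis
  proof (rule that[of xs])
    show "successively R xs" using sx by (rule successively_mono) (auto simp: cross_def)
    show "set xs \<subseteq> A \<union> B" using Q(3) A' B' set_take_subset[of r Q] by (auto simp: xs_def)
    show "distinct xs" using Q(2) by (simp add: xs_def)
    have "last xs \<in> side (r - 1) A' B'"
      using cross_path_side[OF sx hx dis', of "r - 1"] lx ne r by (simp add: last_conv_nth)
    then show "last xs \<in> side (r - 1) A B" using A' B' by (auto simp: side_def split: if_splits)
  qed (use lx hx A' in auto)
qed

section \<open>Cycles and holes\<close>

text \<open>A path on \<open>l - 2d - 2\<close> vertices outside the reserve has an even number of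
  vertices, hence ends on opposite sides, and the reserve links these. The constant 26 is 23 for
  \<open>joined_linked\<close> plus 3 for \<open>joined_path\<close>.\<close>

lemma joined_even_cycle:
  assumes J: "joined R m A B" and sym: "symp R" and fin: "finite A" "finite B"
    and dis: "A \<inter> B = {}" and m: "m \<le> 2 ^ D"
    and card: "26 * m \<le> card A" "26 * m \<le> card B"
    and l: "even l" "2 * D + 4 \<le> l" "l \<le> m"
  shows "has_cycle R l"
proof -
  have m0: "0 < m" using l by linarith
  have c22: "22 * m \<le> card A" "22 * m \<le> card B" using card by linarith+
  obtain d GA GB T where d: "d \<le> D" and G: "GA \<subseteq> A - T" "GB \<subseteq> B - T"
    "card A \<le> card GA + 23 * m" "card B \<le> card GB + 23 * m"
    and link: "\<And>x z. x \<in> GA \<Longrightarrow> z \<in> GB \<Longrightarrow> \<exists>xs. length xs = 2 * d + 2 \<and> distinct xs \<and>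
       set xs \<subseteq> T \<and> successively R (x # xs @ [z])"
    by (rule joined_linked[OF J sym fin dis m0 m c22]) (rule that; assumption)
  have Gs: "GA \<subseteq> A" "GB \<subseteq> B" using G by auto
  define r where "r = l - 2 * d - 2"
  have r: "even r" "0 < r" "r < m" "l = r + (2 * d + 2)" using l d m0 unfolding r_def by auto
  obtain ps where ps: "length ps = r" "distinct ps" "successively R ps" "set ps \<subseteq> GA \<union> GB"
    "hd ps \<in> GA" "last ps \<in> side (r - 1) GA GB"
  proof (rule joined_path[OF joined_mono[OF J Gs] sym])
    show "finite GA" "finite GB" using fin Gs by (meson finite_subset)+
    show "GA \<inter> GB = {}" using Gs dis by auto
    show "3 * m \<le> card GA" "3 * m \<le> card GB" using G card by linarith+
  qed (use m0 r in blast)+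
  have "odd (r - 1)" using r by simp
  then have "last ps \<in> GB" using ps(6) by (simp add: side_def)
  from link[OF ps(5) this] obtain xs where xs: "length xs = 2 * d + 2" "distinct xs"
    "set xs \<subseteq> T" "successively R (hd ps # xs @ [last ps])" by blast
  have "has_cycle R (length ps + length xs)"
  proof (rule has_cycleI[OF sym _ ps(2,3) xs(2)])
    show "set ps \<inter> set xs = {}" using ps(4) xs(3) G by blast
    show "ps \<noteq> []" using ps(1) r by auto
  qed (use xs in auto)
  then show ?thesis using ps(1) xs(1) r by simp
qed

text \<open>An edge \<open>x y\<close> inside \<open>A\<close>, put before a path with an odd number
  of vertices and both ends in \<open>B\<close>, shifts the parity: the ends are now
  \<open>x\<close> in \<open>A\<close> and a vertex of \<open>B\<close>, and the reserve closes an
  odd cycle. So few vertices outside the reserve and the room for such paths can lie on an edge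
  there.\<close>

lemma joined_odd_cycle_or_independent:
  assumes J: "joined R m A B" and sym: "symp R" and irr: "irreflp R" and fin: "finite A" "finite B"
    and dis: "A \<inter> B = {}" and m: "m \<le> 2 ^ D"
    and card: "28 * m \<le> card A" "28 * m \<le> card B"
    and l: "odd l" "2 * D + 4 \<le> l" "l \<le> m" and ncyc: "\<not> has_cycle R l"
  obtains A' where "A' \<subseteq> A" "card A \<le> card A' + 28 * m" "\<forall>x\<in>A'. \<forall>y\<in>A'. \<not> R x y"
proof -
  have m0: "0 < m" using l by linarith
  have c22: "22 * m \<le> card A" "22 * m \<le> card B" using card by linarith+
  obtain d GA GB T where d: "d \<le> D" and G: "GA \<subseteq> A - T" "GB \<subseteq> B - T"
    "card A \<le> card GA + 23 * m" "card B \<le> card GB + 23 * m"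
    and link: "\<And>x z. x \<in> GA \<Longrightarrow> z \<in> GB \<Longrightarrow> \<exists>xs. length xs = 2 * d + 2 \<and> distinct xs \<and>
       set xs \<subseteq> T \<and> successively R (x # xs @ [z])"
    by (rule joined_linked[OF J sym fin dis m0 m c22]) (rule that; assumption)
  have Gs: "GA \<subseteq> A" "GB \<subseteq> B" using G by auto
  have "4 * m \<le> card GA" "4 * m \<le> card GB" using G card by linarith+
  then obtain A3 B3 where A3: "A3 \<subseteq> GA" "card A3 = 4 * m" and B3: "B3 \<subseteq> GB" "card B3 = 4 * m"
    using obtain_subset_with_card_n by metis
  have fin3: "finite A3" "finite B3" "finite GA"
    using A3 B3 Gs fin by (meson finite_subset)+
  \<comment> \<open>The link takes \<open>2 * d + 2\<close> vertices and the inner edge 2. As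
    \<open>l\<close> is odd it differs from \<open>2 * d + 4\<close>, which leaves \<open>r\<close>
    positive.\<close>
  define r where "r = l - 2 * d - 4"
  have r: "odd r" "0 < r" "r < m" "l = r + 2 + (2 * d + 2)"
  proof -
    have "l \<noteq> 2 * d + 4" using l(1) by auto
    then have "l > 2 * d + 4" using l(2) d by linarith
    then show "0 < r" "r < m" "l = r + 2 + (2 * d + 2)" using l(3) unfolding r_def by auto
    then show "odd r" using l(1) by auto
  qed
  let ?path = "\<lambda>ps. length ps = r \<and> distinct ps \<and> successively R ps \<and> set ps \<subseteq> A3 \<union> B3 \<and>
      last ps \<in> B3"
  \<comment> \<open>\<open>W\<close> collects the possible first vertices. If it had fewer than
    \<open>m\<close>, then \<open>joined_path\<close> on the other \<open>3 * m\<close> vertices of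
    \<open>B3\<close> would produce a new one.\<close>
  define W where "W = {v \<in> B3. \<exists>ps. ?path ps \<and> hd ps = v}"
  have W: "m \<le> card W"
  proof (rule ccontr)
    assume "\<not> m \<le> card W"
    moreover have "card (B3 - W) = card B3 - card W"
      using fin3 by (intro card_Diff_subset) (auto simp: W_def)
    ultimately have big: "3 * m \<le> card (B3 - W)" using B3 by simp
    have sub: "B3 - W \<subseteq> B" "A3 \<subseteq> A" using A3 B3 Gs by auto
    obtain ps where ps: "length ps = r" "distinct ps" "successively R ps"
      "set ps \<subseteq> (B3 - W) \<union> A3" "hd ps \<in> B3 - W" "last ps \<in> side (r - 1) (B3 - W) A3"
    proof (rule joined_path[OF joined_mono[OF joined_swap[OF J sym] sub] sym])
      show "(B3 - W) \<inter> A3 = {}" using sub dis by auto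
    qed (use m0 r big A3 fin3 in auto)
    moreover have "even (r - 1)" using r by simp
    ultimately have "?path ps" by (auto simp: side_def)
    then show False using ps(5) unfolding W_def by blast
  qed
  define X where "X = GA - A3"
  \<comment> \<open>With \<open>m\<close> vertices, \<open>Y\<close> would have an edge to
    \<open>W\<close>, and a neighbour in \<open>X\<close> of its end would complete the
    cycle.\<close>
  define Y where "Y = {y \<in> X. \<exists>x\<in>X. R x y}"
  have "card Y < m"
  proof (rule ccontr)
    assume "\<not> card Y < m"
    moreover have "Y \<subseteq> A" "W \<subseteq> B" using Gs B3 by (auto simp: X_def Y_def W_def)
    ultimately obtain y v where yv: "y \<in> Y" "v \<in> W" "R y v" 
      using joinedE[OF J, of Y W] W by (metis not_less)
    obtain ps where ps: "?path ps" "hd ps = v" using yv(2) unfolding W_def by blast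
    obtain x where x: "x \<in> X" "R x y" using yv(1) unfolding Y_def by blast
    have yX: "y \<in> X" using yv(1) unfolding Y_def by blast
    have pne: "ps \<noteq> []" using ps(1) r by auto
    let ?qs = "x # y # ps"
    have xG: "x \<in> GA" "y \<in> GA" "last ps \<in> GB" using x yX ps(1) B3 by (auto simp: X_def)
    from link[OF xG(1,3)] obtain xs where xs: "length xs = 2 * d + 2" "distinct xs"
      "set xs \<subseteq> T" "successively R (x # xs @ [last ps])" by blast
    have "GA \<inter> B3 = {}" using Gs B3(1) dis by blast
    then have xy: "x \<notin> A3 \<union> B3" "y \<notin> A3 \<union> B3" "x \<noteq> y"
      using x yX irr by (auto simp: X_def irreflp_def)
    have "has_cycle R (length ?qs + length xs)"
    proof (rule has_cycleI[OF sym])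
      show "distinct ?qs" using ps(1) xy by auto
      show "successively R ?qs"
        using ps pne x(2) yv(3) by (auto simp: successively_Cons)
      have "A3 \<union> B3 \<union> GA \<subseteq> - T" using A3(1) B3(1) G(1,2) by blast
      moreover have "set ?qs \<subseteq> A3 \<union> B3 \<union> GA" using ps(1) xG by auto
      ultimately show "set ?qs \<inter> set xs = {}" using xs(3) by blast
    qed (use xs pne in auto)
    then show False using ncyc ps(1) xs(1) r(4) by (auto simp: algebra_simps)
  qed
  moreover have "card X = card GA - 4 * m"
    using A3 fin3 unfolding X_def by (simp add: card_Diff_subset)
  moreover have "card (X - Y) = card X - card Y"
    using fin3 by (intro card_Diff_subset) (auto simp: X_def Y_def)
  \<comment> \<open>The loss is \<open>23 * m\<close> for the links, \<open>4 * m\<close> for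
    \<open>A3\<close> and less than \<open>m\<close> for \<open>Y\<close>.\<close>
  ultimately have "card A \<le> card (X - Y) + 28 * m" using G(3) by linarith
  moreover have "X - Y \<subseteq> A" using Gs by (auto simp: X_def)
  moreover have "\<forall>x\<in>X - Y. \<forall>y\<in>X - Y. \<not> R x y" by (auto simp: Y_def)
  ultimately show ?thesis using that by blast
qed

section \<open>Removing the colours one at a time\<close>

fun odd_bound :: "nat \<Rightarrow> nat" where
  "odd_bound 0 = 2"
| "odd_bound (Suc k) = odd_bound k * (odd_bound k + 28)"

lemma odd_bound_ge: "2 \<le> odd_bound k"
proof (induction k)
  case (Suc k)
  then have "2 * 1 \<le> odd_bound k * (odd_bound k + 28)" by (intro mult_le_mono) auto
  then show ?case by simp
qed simp

text \<open>If the new colour is joined across the pair \<^term>\<open>A\<close>, \<^term>\<open>B\<close> obtained from the other colours, it is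
  absent from a large part of \<^term>\<open>A\<close>, to which the induction hypothesis applies once more.\<close>

lemma odd_colours_hole:
  assumes "finite I" "\<And>i. i \<in> I \<Longrightarrow> symp (R i)" "\<And>i. i \<in> I \<Longrightarrow> irreflp (R i)"
    "\<And>i. i \<in> I \<Longrightarrow> odd (l i)" "\<And>i. i \<in> I \<Longrightarrow> 2 * D + 4 \<le> l i" "\<And>i. i \<in> I \<Longrightarrow> l i \<le> M"
    "\<And>i. i \<in> I \<Longrightarrow> \<not> has_cycle (R i) (l i)"
    "finite V" "odd_bound (card I) * M \<le> card V" "odd_bound (card I) * M \<le> 2 ^ Suc D"
  shows "\<exists>A B. A \<subseteq> V \<and> B \<subseteq> V \<and> A \<inter> B = {} \<and> card A = M \<and> card B = M \<and>
           (\<forall>i\<in>I. \<forall>x\<in>A. \<forall>y\<in>B. \<not> R i x y)"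
  using assms
proof (induction I arbitrary: M V rule: finite_induct)
  case empty
  then obtain A where A: "A \<subseteq> V" "card A = M"
    using obtain_subset_with_card_n[of M V] by auto
  have "M \<le> card (V - A)" using empty A by (simp add: card_Diff_subset finite_subset)
  then obtain B where "B \<subseteq> V - A" "card B = M" using obtain_subset_with_card_n by metis
  then show ?case using A by blast
next
  case (insert i I)
  let ?c = "odd_bound (card I)"
  \<comment> \<open>Sets of this size can lose \<open>28 * M\<close> vertices to become free of
    colour \<open>i\<close> and still keep the \<open>?c * M\<close> needed to apply the induction
    hypothesis inside \<open>A\<close>.\<close>
  let ?M = "(?c + 28) * M"
  have eq: "odd_bound (card (insert i I)) * M = ?c * ?M"
    using insert.hyps by (simp add: algebra_simps)
  have MM: "M \<le> ?M" by simp
  have l': "\<And>j. j \<in> I \<Longrightarrow> l j \<le> ?M" using insert.prems(5) MM by (meson insertI2 le_trans)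
  obtain A B where AB: "A \<subseteq> V" "B \<subseteq> V" "A \<inter> B = {}" "card A = ?M" "card B = ?M"
      "\<forall>i\<in>I. \<forall>x\<in>A. \<forall>y\<in>B. \<not> R i x y"
    using insert.IH[of ?M V] insert.prems l' eq by auto
  have finAB: "finite A" "finite B" using AB insert.prems(7) by (meson finite_subset)+
  \<comment> \<open>Since \<open>odd_bound\<close> is at least 2, the bound \<open>2 ^ Suc D\<close>
    on the whole set gives the bound \<open>2 ^ D\<close> that the tree depth requires.\<close>
  have "2 * M \<le> ?c * ?M" using odd_bound_ge[of "card I"] MM by (intro mult_le_mono) auto
  then have "2 * M \<le> 2 * 2 ^ D" using insert.prems(9) unfolding eq power_Suc by (rule le_trans)
  then have M2: "M \<le> 2 ^ D" by simp
  show ?case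
  proof (cases "joined (R i) M A B")
    case False
    then obtain X Y where XY: "X \<subseteq> A" "Y \<subseteq> B" "card X = M" "card Y = M"
      "\<forall>x\<in>X. \<forall>y\<in>Y. \<not> R i x y" by (rule not_joinedE)
    have "X \<subseteq> V" "Y \<subseteq> V" using XY(1,2) AB(1,2) by simp_all
    moreover have "X \<inter> Y = {}" using XY(1,2) AB(3) by blast
    moreover have "\<forall>j\<in>I. \<forall>x\<in>X. \<forall>y\<in>Y. \<not> R j x y" 
      using AB(6) subsetD[OF XY(1)] subsetD[OF XY(2)] by simp
    ultimately have "X \<subseteq> V \<and> Y \<subseteq> V \<and> X \<inter> Y = {} \<and> card X = M \<and> card Y = M \<and>
           (\<forall>j\<in>insert i I. \<forall>x\<in>X. \<forall>y\<in>Y. \<not> R j x y)" using XY(3-5) by simp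
    then show ?thesis by blast
  next
    case True
    have "28 * M \<le> card A" "28 * M \<le> card B" using AB by simp_all
    then obtain A' where A': "A' \<subseteq> A" "card A \<le> card A' + 28 * M" "\<forall>x\<in>A'. \<forall>y\<in>A'. \<not> R i x y"
      using joined_odd_cycle_or_independent[OF True _ _ finAB AB(3) M2, of "l i"] insert.prems
      by (metis insertI1)
    have "?c * M \<le> card A'" using A'(2) AB(4) by (simp add: algebra_simps)
    moreover have "?c * M \<le> 2 ^ Suc D"
      using insert.prems(9) eq MM by (metis le_trans mult_le_mono2)
    ultimately obtain X Y where XY: "X \<subseteq> A'" "Y \<subseteq> A'" "X \<inter> Y = {}" "card X = M" "card Y = M"
      "\<forall>i\<in>I. \<forall>x\<in>X. \<forall>y\<in>Y. \<not> R i x y"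
      using insert.IH[of M A'] insert.prems finAB A' finite_subset[of A' A] by auto
    have "X \<subseteq> V" "Y \<subseteq> V" using XY(1,2) A'(1) AB(1) by blast+
    moreover have "\<forall>x\<in>X. \<forall>y\<in>Y. \<not> R i x y"
      using A'(3) subsetD[OF XY(1)] subsetD[OF XY(2)] by simp
    ultimately have "X \<subseteq> V \<and> Y \<subseteq> V \<and> X \<inter> Y = {} \<and> card X = M \<and> card Y = M \<and>
           (\<forall>j\<in>insert i I. \<forall>x\<in>X. \<forall>y\<in>Y. \<not> R j x y)" using XY(3-6) by simp
    then show ?thesis by blast
  qed
qed

text \<open>A joined pair would contain the even cycle, so each colour has a hole, and the next
  colour is treated inside it. The factor 81 covers the 26 of
  \<open>joined_even_cycle\<close>.\<close>

lemma even_colours_hole: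
  assumes "finite I" "\<And>i. i \<in> I \<Longrightarrow> symp (R i)"
    "\<And>i. i \<in> I \<Longrightarrow> even (l i)" "\<And>i. i \<in> I \<Longrightarrow> 2 * D + 4 \<le> l i" "\<And>i. i \<in> I \<Longrightarrow> l i \<le> n"
    "\<And>i. i \<in> I \<Longrightarrow> \<not> has_cycle (R i) (l i)"
    "finite A" "finite B" "A \<inter> B = {}" "81 ^ card I * n \<le> card A" "81 ^ card I * n \<le> card B"
    "81 ^ card I * n \<le> 2 ^ D"
  shows "\<exists>X Y. X \<subseteq> A \<and> Y \<subseteq> B \<and> card X = n \<and> card Y = n \<and> (\<forall>i\<in>I. \<forall>x\<in>X. \<forall>y\<in>Y. \<not> R i x y)"
  using assms
proof (induction I arbitrary: A B rule: finite_induct)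
  case empty
  then obtain X Y where "X \<subseteq> A" "card X = n" "Y \<subseteq> B" "card Y = n"
    by (metis card.empty mult_1 obtain_subset_with_card_n power_0)
  then show ?case by blast
next
  case (insert i I)
  let ?m = "81 ^ card I * n"
  have c: "81 * ?m \<le> card A" "81 * ?m \<le> card B" "81 * ?m \<le> 2 ^ D"
    using insert.prems(9-11) insert.hyps by simp_all
  have nm: "n \<le> ?m" by simp
  have "\<not> joined (R i) ?m A B"
  proof
    assume J: "joined (R i) ?m A B"
    have "has_cycle (R i) (l i)"
    proof (rule joined_even_cycle[OF J])
      show "l i \<le> ?m" using insert.prems(4)[of i] nm by (meson insertI1 le_trans)
    qed (use insert.prems c in auto)
    then show False using insert.prems(5) by simp
  qed
  then obtain X Y where XY: "X \<subseteq> A" "Y \<subseteq> B" "card X = ?m" "card Y = ?m" "\<forall>x\<in>X. \<forall>y\<in>Y. \<not> R i x y"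
    by (rule not_joinedE)
  have "finite X" "finite Y" "X \<inter> Y = {}" "?m \<le> 2 ^ D"
    using XY insert.prems c by (auto intro: finite_subset)
  then obtain X' Y' where XY': "X' \<subseteq> X" "Y' \<subseteq> Y" "card X' = n" "card Y' = n"
     "\<forall>i\<in>I. \<forall>x\<in>X'. \<forall>y\<in>Y'. \<not> R i x y"
    using insert.IH[of X Y] insert.prems XY by auto
  have "X' \<subseteq> A" "Y' \<subseteq> B" using XY XY' by simp_all
  moreover have "\<forall>x\<in>X'. \<forall>y\<in>Y'. \<not> R i x y"
    using XY(5) subsetD[OF XY'(1)] subsetD[OF XY'(2)] by simp
  ultimately have "X' \<subseteq> A \<and> Y' \<subseteq> B \<and> card X' = n \<and> card Y' = n \<and>
      (\<forall>j\<in>insert i I. \<forall>x\<in>X'. \<forall>y\<in>Y'. \<not> R j x y)" using XY'(3-5) by simp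
  then show ?case by blast
qed

section \<open>Sparse joined graphs\<close>

text \<open>One term of the exponential series at \<open>n\<close> is at most the sum.\<close>

lemma pow_self_le_exp_fact: "real n ^ n \<le> exp (real n) * fact n"
proof -
  have "sum (\<lambda>k. real n ^ k /\<^sub>R fact k) {n} \<le> suminf (\<lambda>k. real n ^ k /\<^sub>R fact k)"
    by (intro sum_le_suminf sums_summable[OF exp_converges]) auto
  also have "\<dots> = exp (real n)" using exp_converges[of "real n"] by (simp add: sums_iff)
  finally show ?thesis by (simp add: field_simps)
qed

lemma binomial_mult_le_exp:
  assumes "0 < n" "0 < c"
  shows "real ((c * n) choose n) \<le> exp (real n * (ln (real c) + 1))"
proof -
  have "real ((c * n) choose n) * fact n \<le> real (c * n) ^ n"
    using binomial_fact_pow[of "c * n" n] by (metis of_nat_fact of_nat_le_iff of_nat_mult of_nat_power)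
  also have "\<dots> = real c ^ n * real n ^ n" by (simp add: power_mult_distrib)
  also have "\<dots> \<le> real c ^ n * (exp (real n) * fact n)"
    by (intro mult_left_mono pow_self_le_exp_fact) auto
  also have "real c ^ n = exp (real n * ln (real c))"
    using assms by (simp add: exp_of_nat_mult)
  finally show ?thesis by (simp add: algebra_simps exp_add)
qed

text \<open>Union bound over the pairs \<^term>\<open>(X, Y)\<close> for a uniformly random list of \<^term>\<open>q\<close> ordered pairs,
  phrased as a count of lists.\<close>

lemma sparse_joined_graph_exists:
  fixes n c q :: nat
  assumes n: "0 < n" and c: "2 \<le> c" and q: "real n * (real c)\<^sup>2 * (ln (real c) + 1) < real q"
  obtains E where "simple_graph E" "card E \<le> q"
    "\<And>X Y. X \<subseteq> {..<c * n} \<Longrightarrow> Y \<subseteq> {..<c * n} \<Longrightarrow> X \<inter> Y = {} \<Longrightarrow> card X = n \<Longrightarrow> card Y = n \<Longrightarrow>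
       \<exists>x\<in>X. \<exists>y\<in>Y. {x, y} \<in> E"
proof -
  define N where "N = c * n"
  define V where "V = {..<N}"
  \<comment> \<open>Loops and repeated entries are allowed so that the counts are exact powers;
    passing to \<open>E\<close> drops them and only lowers the number of edges.\<close>
  define U where "U = V \<times> V"
  define subs where "subs = {X. X \<subseteq> V \<and> card X = n}"
  define pairs where "pairs = {p \<in> subs \<times> subs. fst p \<inter> snd p = {}}"
  define bad where "bad p = {xs. set xs \<subseteq> U - (fst p \<times> snd p \<union> snd p \<times> fst p) \<and> length xs = q}"
    for p
  define L where "L = {xs. set xs \<subseteq> U \<and> length xs = q}"
  have finV: "finite V" and finU: "finite U" by (simp_all add: V_def U_def)
  have cU: "card U = N\<^sup>2" by (simp add: U_def V_def card_cartesian_product power2_eq_square)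
  have fins: "finite subs" unfolding subs_def using finV by simp
  have csubs: "card subs = N choose n" unfolding subs_def using n_subsets[OF finV] by (simp add: V_def)
  have finp: "finite pairs" unfolding pairs_def using fins by simp
  have "card pairs \<le> card (subs \<times> subs)" unfolding pairs_def using fins by (intro card_mono) auto
  then have cpairs: "card pairs \<le> (N choose n)\<^sup>2"
    by (simp add: card_cartesian_product csubs power2_eq_square)
  have cbad: "card (bad p) = (N\<^sup>2 - 2 * n\<^sup>2) ^ q" if p: "p \<in> pairs" for p
  proof -
    obtain X Y where XY: "p = (X, Y)" "X \<subseteq> V" "Y \<subseteq> V" "card X = n" "card Y = n" "X \<inter> Y = {}"
      using p unfolding pairs_def subs_def by (cases p) auto
    have fXY: "finite X" "finite Y" using XY finV by (meson finite_subset)+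
    have "card (X \<times> Y \<union> Y \<times> X) = card (X \<times> Y) + card (Y \<times> X)"
      using fXY XY(6) by (intro card_Un_disjoint) auto
    then have "card (X \<times> Y \<union> Y \<times> X) = 2 * n\<^sup>2"
      using XY by (simp add: card_cartesian_product power2_eq_square)
    moreover have "X \<times> Y \<union> Y \<times> X \<subseteq> U" using XY unfolding U_def by auto
    ultimately have "card (U - (X \<times> Y \<union> Y \<times> X)) = N\<^sup>2 - 2 * n\<^sup>2"
      using fXY cU by (subst card_Diff_subset) auto
    then show ?thesis unfolding bad_def XY(1)
      using card_lists_length_eq[of "U - (X \<times> Y \<union> Y \<times> X)" q] finU by simp
  qed
  have "card (\<Union>p\<in>pairs. bad p) \<le> (\<Sum>p\<in>pairs. card (bad p))" by (rule card_UN_le[OF finp])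
  also have "\<dots> = card pairs * (N\<^sup>2 - 2 * n\<^sup>2) ^ q" using cbad by simp
  also have "\<dots> \<le> (N choose n)\<^sup>2 * (N\<^sup>2 - 2 * n\<^sup>2) ^ q" using cpairs by simp
  also have "\<dots> < (N\<^sup>2) ^ q"
  proof -
    have c0: "0 < real c" "2 \<le> (real c)\<^sup>2" using c power_mono[of 2 "real c" 2] by auto
    have le: "2 * n\<^sup>2 \<le> N\<^sup>2"
      unfolding N_def power_mult_distrib using c power_mono[of 2 c 2] by (intro mult_right_mono) auto
    have "real (N\<^sup>2 - 2 * n\<^sup>2) = real (N\<^sup>2) * (1 - 2 / (real c)\<^sup>2)"
      using le c0 by (simp add: of_nat_diff N_def field_simps power_mult_distrib)
    then have e1: "real ((N\<^sup>2 - 2 * n\<^sup>2) ^ q) = real (N\<^sup>2) ^ q * (1 - 2 / (real c)\<^sup>2) ^ q"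
      by (simp add: power_mult_distrib)
    have "(1 - 2 / (real c)\<^sup>2) ^ q \<le> exp (- (2 / (real c)\<^sup>2)) ^ q"
      using c0 exp_ge_add_one_self[of "- (2 / (real c)\<^sup>2)"] by (intro power_mono) auto
    also have "\<dots> = exp (- (2 * real q / (real c)\<^sup>2))"
      by (simp add: exp_of_nat_mult[symmetric])
    finally have e2: "(1 - 2 / (real c)\<^sup>2) ^ q \<le> exp (- (2 * real q / (real c)\<^sup>2))" .
    have "real (N choose n) \<le> exp (real n * (ln (real c) + 1))"
      unfolding N_def using binomial_mult_le_exp[of n c] n c by simp
    then have "(real (N choose n))\<^sup>2 \<le> (exp (real n * (ln (real c) + 1)))\<^sup>2"
      by (intro power_mono) auto
    also have "\<dots> = exp (2 * (real n * (ln (real c) + 1)))"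
      by (simp add: exp_double)
    finally have "(real (N choose n))\<^sup>2 * (1 - 2 / (real c)\<^sup>2) ^ q
        \<le> exp (2 * (real n * (ln (real c) + 1))) * exp (- (2 * real q / (real c)\<^sup>2))"
      using e2 c0 by (intro mult_mono) auto
    also have "\<dots> = exp (2 * (real n * (ln (real c) + 1)) - 2 * real q / (real c)\<^sup>2)"
      by (simp add: exp_add[symmetric])
    \<comment> \<open>Both orientations of a pair are avoided in a bad list, which gives the 2 in
      \<open>2 * real q\<close>; it cancels the 2 from choosing two sets, leaving exactly the
      hypothesis on \<open>q\<close>.\<close>
    also have "\<dots> < 1" using q c0 by (simp add: field_simps)
    finally have "real (N\<^sup>2) ^ q * ((real (N choose n))\<^sup>2 * (1 - 2 / (real c)\<^sup>2) ^ q) < real (N\<^sup>2) ^ q * 1"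
      using n c by (intro mult_strict_left_mono) (auto simp: N_def)
    then have "real ((N choose n)\<^sup>2 * (N\<^sup>2 - 2 * n\<^sup>2) ^ q) < real ((N\<^sup>2) ^ q)"
      using e1 by (simp add: mult_ac)
    then show ?thesis by (simp only: of_nat_less_iff)
  qed
  also have "\<dots> = card L" unfolding L_def using card_lists_length_eq[OF finU, of q] cU by simp
  finally have "card (\<Union>p\<in>pairs. bad p) < card L" .
  moreover have "finite (\<Union>p\<in>pairs. bad p)"
    unfolding bad_def using finp finU by (intro finite_UN_I finite_lists_length_eq) auto
  ultimately have "\<not> L \<subseteq> (\<Union>p\<in>pairs. bad p)" using card_mono by (metis not_less)
  then obtain xs where xs: "set xs \<subseteq> U" "length xs = q" "\<And>p. p \<in> pairs \<Longrightarrow> xs \<notin> bad p"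
    unfolding L_def by blast
  define E where "E = (\<lambda>(x, y). {x, y}) ` {e \<in> set xs. fst e \<noteq> snd e}"
  show ?thesis
  proof (rule that[of E])
    show "simple_graph E" unfolding simple_graph_def E_def by auto
    have "card E \<le> card {e \<in> set xs. fst e \<noteq> snd e}" unfolding E_def by (intro card_image_le) simp
    also have "\<dots> \<le> card (set xs)" by (intro card_mono) auto
    also have "\<dots> \<le> q" using card_length[of xs] xs(2) by simp
    finally show "card E \<le> q" .
    fix X Y assume XY: "X \<subseteq> {..<c * n}" "Y \<subseteq> {..<c * n}" "X \<inter> Y = {}" "card X = n" "card Y = n"
    then have "(X, Y) \<in> pairs" by (simp add: pairs_def subs_def V_def N_def)
    from xs(3)[OF this] xs(1,2) obtain e where e: "e \<in> set xs" "e \<in> X \<times> Y \<union> Y \<times> X"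
      unfolding bad_def by auto
    then have "fst e \<noteq> snd e" using XY(3) by auto
    then have eE: "{fst e, snd e} \<in> E" unfolding E_def using e(1)
      by (intro image_eqI[of _ _ e]) (auto split: prod.splits)
    consider "fst e \<in> X" "snd e \<in> Y" | "snd e \<in> X" "fst e \<in> Y" using e(2) by auto
    then show "\<exists>x\<in>X. \<exists>y\<in>Y. {x, y} \<in> E"
    proof cases
      case 1
      then show ?thesis using eE by blast
    next
      case 2
      then show ?thesis using eE insert_commute[of "fst e" "snd e" "{}"] by metis
    qed
  qed
qed

section \<open>The size-Ramsey bound\<close>

lemma has_cycle_imp_has_mono_cycle:
  assumes "has_cycle (\<lambda>x y. {x, y} \<in> E \<and> col {x, y} = i) k" "0 < k"
  shows "has_mono_cycle E col i k"
proof -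
  let ?R = "\<lambda>x y. {x, y} \<in> E \<and> col {x, y} = i"
  obtain xs where xs: "length xs = k" "distinct xs" "successively ?R xs" "?R (last xs) (hd xs)"
    using assms(1) unfolding has_cycle_def by blast
  have ne: "xs \<noteq> []" using xs(1) assms(2) by auto
  show ?thesis unfolding has_mono_cycle_def
  proof (intro exI[of _ "(!) xs"] conjI allI impI)
    show "inj_on ((!) xs) {..<k}" using xs(1,2) by (simp add: inj_on_nth)
    fix j assume j: "j < k"
    have "?R (xs ! j) (xs ! ((j + 1) mod k))"
    proof (cases "Suc j < k")
      case True
      then show ?thesis using xs(1,3) by (simp add: successively_conv_nth)
    next
      case False
      then have "Suc j = k" using j by simp
      then show ?thesis using xs(1,4) ne by (auto simp: last_conv_nth hd_conv_nth)
    qed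
    then show "{xs ! j, xs ! ((j + 1) mod k)} \<in> E" "col {xs ! j, xs ! ((j + 1) mod k)} = i"
      by blast+
  qed
qed

text \<open>The odd colours come first because their recursion works inside a single set, whereas
  each even colour only shrinks a given pair.\<close>

lemma joined_graph_arrows_cycles:
  fixes n D :: nat and ns :: "nat list"
  defines "N \<equiv> odd_bound (num_odd ns) * 81 ^ num_even ns * n"
  assumes E: "simple_graph E"
    and J: "\<And>X Y. X \<subseteq> {..<N} \<Longrightarrow> Y \<subseteq> {..<N} \<Longrightarrow> X \<inter> Y = {} \<Longrightarrow> card X = n \<Longrightarrow> card Y = n \<Longrightarrow>
       \<exists>x\<in>X. \<exists>y\<in>Y. {x, y} \<in> E"
    and ns: "\<And>k. k \<in> set ns \<Longrightarrow> 2 * D + 4 \<le> k" "\<And>k. k \<in> set ns \<Longrightarrow> k \<le> n"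
    and ND: "N \<le> 2 ^ Suc D"
  shows "arrows_cycles E ns"
  unfolding arrows_cycles_def
proof (intro allI impI, rule ccontr)
  fix col assume col: "\<forall>e\<in>E. col e < length ns"
    and neg: "\<not> (\<exists>i<length ns. has_mono_cycle E col i (ns ! i))"
  define R where "R i x y \<longleftrightarrow> {x, y} \<in> E \<and> col {x, y} = i" for i x y
  have sym: "symp (R i)" for i by (auto simp: R_def symp_def insert_commute)
  have "{x} \<notin> E" for x using E unfolding simple_graph_def by force
  then have irr: "irreflp (R i)" for i by (auto simp: R_def irreflp_def)
  define I J where "I = {i. i < length ns \<and> odd (ns ! i)}" and "J = {i. i < length ns \<and> even (ns ! i)}"
  have cI: "card I = num_odd ns" "card J = num_even ns"
    unfolding I_def J_def num_odd_def num_even_def by (simp_all add: length_filter_conv_card)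
  have fin: "finite I" "finite J" unfolding I_def J_def by simp_all
  have ncyc: "\<not> has_cycle (R i) (ns ! i)" if "i < length ns" for i
  proof
    assume "has_cycle (R i) (ns ! i)"
    moreover have "0 < ns ! i" using ns(1)[of "ns ! i"] that by auto
    ultimately show False
      using neg that has_cycle_imp_has_mono_cycle[of E col i "ns ! i"] unfolding R_def[abs_def] by blast
  qed
  have len: "2 * D + 4 \<le> ns ! i" "ns ! i \<le> n" if "i < length ns" for i
    using ns that by auto
  let ?M = "81 ^ num_even ns * n"
  have nM: "n \<le> ?M" by simp
  have eq: "odd_bound (card I) * ?M = N" unfolding N_def cI by (simp add: mult_ac)
  have lenM: "ns ! i \<le> ?M" if "i < length ns" for i using len(2)[OF that] nM by (rule le_trans)
  have "\<exists>A B. A \<subseteq> {..<N} \<and> B \<subseteq> {..<N} \<and> A \<inter> B = {} \<and> card A = ?M \<and> card B = ?M \<and>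
           (\<forall>i\<in>I. \<forall>x\<in>A. \<forall>y\<in>B. \<not> R i x y)"
    by (rule odd_colours_hole[where l = "\<lambda>i. ns ! i" and D = D])
       (use fin sym irr ncyc len lenM eq ND in \<open>simp_all add: I_def\<close>)
  then obtain A B where AB: "A \<subseteq> {..<N}" "B \<subseteq> {..<N}" "A \<inter> B = {}" "card A = ?M" "card B = ?M"
      "\<forall>i\<in>I. \<forall>x\<in>A. \<forall>y\<in>B. \<not> R i x y"
    by blast
  have "2 * ?M \<le> N" unfolding eq[symmetric] by (intro mult_le_mono1 odd_bound_ge)
  then have MD: "?M \<le> 2 ^ D" using ND by simp
  have finAB: "finite A" "finite B" using AB by (meson finite_lessThan finite_subset)+
  have "\<exists>X Y. X \<subseteq> A \<and> Y \<subseteq> B \<and> card X = n \<and> card Y = n \<and> (\<forall>i\<in>J. \<forall>x\<in>X. \<forall>y\<in>Y. \<not> R i x y)"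
    by (rule even_colours_hole[where l = "\<lambda>i. ns ! i" and D = D])
       (use fin sym ncyc len AB finAB MD cI in \<open>simp_all add: J_def\<close>)
  then obtain X Y where XY: "X \<subseteq> A" "Y \<subseteq> B" "card X = n" "card Y = n"
      "\<forall>i\<in>J. \<forall>x\<in>X. \<forall>y\<in>Y. \<not> R i x y" by blast
  have "X \<subseteq> {..<N}" "Y \<subseteq> {..<N}" "X \<inter> Y = {}" using XY(1,2) AB(1-3) by blast+
  from J[OF this XY(3,4)] obtain x y where xy: "x \<in> X" "y \<in> Y" "{x, y} \<in> E" by blast
  then have R: "R (col {x, y}) x y" and "col {x, y} < length ns" using col by (auto simp: R_def)
  then have "col {x, y} \<in> I \<union> J" by (auto simp: I_def J_def)
  then show False using R AB(6) XY xy by blast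
qed

section \<open>Comparison of the constants and conclusion\<close>

lemma odd_bound_Suc_le: "real (odd_bound (Suc k)) \<le> 81 * 35 powr (2 ^ Suc k - 2)"
proof (induction k)
  case 0
  then show ?case by simp
next
  case (Suc k)
  let ?g = "35 powr (2 ^ Suc k - 2 :: real)"
  let ?b = "real (odd_bound (Suc k))"
  have g: "1 \<le> ?g" by (intro ge_one_powr_ge_zero) (auto simp: two_realpow_ge_one)
  have "35 powr (2 ^ Suc (Suc k) - 2 :: real) = 35 powr (2 + ((2 ^ Suc k - 2) + (2 ^ Suc k - 2)))"
    by simp
  also have "\<dots> = 1225 * (?g * ?g)" by (simp only: powr_add) simp
  finally have g2: "35 powr (2 ^ Suc (Suc k) - 2 :: real) = 1225 * (?g * ?g)" .
  have "real (odd_bound (Suc (Suc k))) = ?b * (?b + 28)" by simp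
  \<comment> \<open>As \<open>1 \<le> ?g\<close>, the 28 can be absorbed; then 81 + 28 = 109 is
    below 1225 = 35^2, the factor gained as the exponent \<open>e\<close> becomes
    \<open>2e + 2\<close>.\<close>
  also have "\<dots> \<le> (81 * ?g) * (81 * ?g + 28 * ?g)"
    using Suc g by (intro mult_mono add_mono) auto
  also have "\<dots> \<le> 81 * (1225 * (?g * ?g))" using g by (simp add: algebra_simps)
  finally show ?case unfolding g2 .
qed

lemma num_odd_plus_num_even: "num_odd ns + num_even ns = length ns"
  unfolding num_odd_def num_even_def using sum_length_filter_compl[of even ns] by simp

text \<open>The \<open>+ 1\<close> gives room to round the number of edges down. With an odd colour
  it comes from 82 against 81. For two colours the vertex factor is at most 2 * 81^2 = 13122, below
  95412.\<close>

lemma vertex_factor_le_c_const: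
  assumes "ns \<noteq> []"
  shows "real (odd_bound (num_odd ns) * 81 ^ num_even ns) + 1 \<le> c_const ns"
proof -
  let ?o = "num_odd ns" and ?e = "num_even ns"
  have f: "real (odd_bound ?o * 81 ^ ?e) + 1 \<le> f_const ns"
  proof (cases ?o)
    case 0
    \<comment> \<open>Without odd colours 82/35 exceeds 2 by only 12/35, so one factor 81 is needed
      to gain 1.\<close>
    then have "1 \<le> ?e" using assms num_odd_plus_num_even[of ns] by (cases ns) auto
    then have "(81::real) ^ 1 \<le> 81 ^ ?e" by (intro power_increasing) auto
    moreover have "f_const ns = 82 / 35 * 81 ^ ?e"
      unfolding f_const_def 0 by (simp add: powr_minus)
    ultimately show ?thesis using 0 by simp
  next
    case (Suc k)
    let ?g = "35 powr (2 ^ Suc k - 2 :: real)"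
    have "1 \<le> ?g" by (intro ge_one_powr_ge_zero) (auto simp: two_realpow_ge_one)
    then have "1 * 1 \<le> ?g * 81 ^ ?e" by (intro mult_mono) auto
    moreover have "real (odd_bound ?o) * 81 ^ ?e \<le> 81 * ?g * 81 ^ ?e"
      unfolding Suc using odd_bound_Suc_le[of k] by (intro mult_right_mono) auto
    moreover have "f_const ns = 82 * ?g * 81 ^ ?e" unfolding f_const_def Suc ..
    moreover have "real (odd_bound ?o * 81 ^ ?e) = real (odd_bound ?o) * 81 ^ ?e" by simp
    ultimately show ?thesis by linarith
  qed
  show ?thesis
  proof (cases "length ns = 2")
    case True
    then consider "?o = 0" "?e = 2" | "?o = 1" "?e = 1" | "?o = 2" "?e = 0"
      using num_odd_plus_num_even[of ns] by linarith
    then have "real (odd_bound ?o * 81 ^ ?e) + 1 \<le> 95412"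
      by cases (simp_all add: numeral_2_eq_2)
    then show ?thesis using f True unfolding c_const_def by simp
  qed (use f in \<open>simp add: c_const_def\<close>)
qed

theorem theorem3p2:
  fixes t :: nat
  shows "\<exists>N::nat. \<forall>ns :: nat list.
           length ns = t \<and> (\<forall>k\<in>set ns. k > 0) \<and> ns \<noteq> [] \<and> Max (set ns) \<ge> N \<and>
           (\<forall>k\<in>set ns. real k \<ge> 2 * ceiling (log 2 (real (Max (set ns)) * c_const ns)) + 2)
           \<longrightarrow> real (size_ramsey_cycles ns)
                 \<le> (ln (c_const ns) + 1) * (c_const ns)^2 * real (Max (set ns))"
proof (intro exI[of _ 0] allI impI, elim conjE)
  \<comment> \<open>The threshold 0 is chosen because the argument holds for every
    \<open>n\<close>.\<close>
  fix ns :: "nat list"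
  define n where "n = Max (set ns)"
  define c where "c = c_const ns"
  define L where "L = \<lceil>log 2 (real n * c)\<rceil>"
  define b where "b = odd_bound (num_odd ns) * 81 ^ num_even ns"
  assume ns0: "\<forall>k\<in>set ns. 0 < k" and ne: "ns \<noteq> []"
    and long: "\<forall>k\<in>set ns. real k \<ge> 2 * ceiling (log 2 (real (Max (set ns)) * c_const ns)) + 2"
  have bc: "real b + 1 \<le> c" unfolding b_def c_def by (rule vertex_factor_le_c_const[OF ne])
  have b2: "2 \<le> b"
  proof -
    have "2 * 1 \<le> b" unfolding b_def using odd_bound_ge by (intro mult_le_mono) auto
    then show ?thesis by simp
  qed
  have n_in: "n \<in> set ns" unfolding n_def using ne by simp
  then have n0: "0 < n" using ns0 by simp
  have le_n: "k \<le> n" if "k \<in> set ns" for k using that unfolding n_def by simp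
  have nc: "real (b * n) \<le> real n * c" "2 < real n * c"
  proof -
    have "real n * real b \<le> real n * c" using bc by (intro mult_left_mono) auto
    then show "real (b * n) \<le> real n * c" by (simp add: mult.commute)
    have "1 * c \<le> real n * c" using n0 bc by (intro mult_right_mono) auto
    then show "2 < real n * c" using bc b2 by linarith
  qed
  have "log 2 2 < log 2 (real n * c)" using nc(2) by (subst log_less_cancel_iff) auto
  then have L1: "1 \<le> L" unfolding L_def by simp
  \<comment> \<open>With this shift \<open>2 * L + 2\<close> is \<open>2 * D + 4\<close>, and
    \<open>2 ^ Suc D\<close> bounds \<open>real n * c\<close>, hence the number of vertices.\<close>
  define D where "D = nat L - 1"
  have SD: "int (Suc D) = L" using L1 unfolding D_def by simp
  have "real n * c = 2 powr (log 2 (real n * c))" using nc(2) by simp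
  also have "\<dots> \<le> 2 powr real (Suc D)"
    using SD unfolding L_def by (intro powr_mono) linarith+
  also have "\<dots> = 2 ^ Suc D" by (rule powr_realpow) simp
  finally have "real (b * n) \<le> real (2 ^ Suc D)" using nc(1) by simp
  then have ND: "b * n \<le> 2 ^ Suc D" by (simp only: of_nat_le_iff)
  have lenD: "2 * D + 4 \<le> k" if "k \<in> set ns" for k
  proof -
    have "real k \<ge> real_of_int (2 * L + 2)"
      using long that unfolding L_def n_def c_def by simp
    then show ?thesis using SD by linarith
  qed
  define bound where "bound = (ln c + 1) * c\<^sup>2 * real n"
  define q where "q = nat \<lfloor>bound\<rfloor>"
  \<comment> \<open>Using \<open>b\<close> in place of \<open>c\<close> leaves a gap of at least 1,
    so an integer \<open>q\<close> fits between the edge count required and the bound.\<close>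
  have "real n * (real b)\<^sup>2 * (ln (real b) + 1) + 1 \<le> bound"
  proof -
    have lnb: "0 \<le> ln (real b)" "ln (real b) \<le> ln c" using b2 bc by auto
    have "(real b)\<^sup>2 + 1 \<le> (real b + 1)\<^sup>2" by (simp add: power2_sum)
    also have "\<dots> \<le> c\<^sup>2" using bc by (intro power_mono) auto
    finally have "(real b)\<^sup>2 + 1 \<le> c\<^sup>2" .
    then have "(ln (real b) + 1) * ((real b)\<^sup>2 + 1) \<le> (ln c + 1) * c\<^sup>2"
      using lnb by (intro mult_mono) auto
    moreover have "(ln (real b) + 1) * (real b)\<^sup>2 + 1 \<le> (ln (real b) + 1) * ((real b)\<^sup>2 + 1)"
      using lnb by (simp add: algebra_simps)
    ultimately have "((ln (real b) + 1) * (real b)\<^sup>2 + 1) * real n \<le> bound"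
      unfolding bound_def by (intro mult_right_mono) auto
    then show ?thesis using n0 by (simp add: algebra_simps)
  qed
  then have q: "real n * (real b)\<^sup>2 * (ln (real b) + 1) < real q" "real q \<le> bound"
  proof -
    assume *: "real n * (real b)\<^sup>2 * (ln (real b) + 1) + 1 \<le> bound"
    have "0 \<le> real n * (real b)\<^sup>2 * (ln (real b) + 1)" using b2 by simp
    then have "real q = real_of_int \<lfloor>bound\<rfloor>" unfolding q_def using * by simp
    then show "real n * (real b)\<^sup>2 * (ln (real b) + 1) < real q" "real q \<le> bound"
      using * by linarith+
  qed
  obtain E where E: "simple_graph E" "card E \<le> q"
    "\<And>X Y. X \<subseteq> {..<b * n} \<Longrightarrow> Y \<subseteq> {..<b * n} \<Longrightarrow> X \<inter> Y = {} \<Longrightarrow> card X = n \<Longrightarrow> card Y = n \<Longrightarrow>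
       \<exists>x\<in>X. \<exists>y\<in>Y. {x, y} \<in> E"
    by (rule sparse_joined_graph_exists[OF n0 b2 q(1)]) (rule that; assumption)
  have "arrows_cycles E ns"
    by (rule joined_graph_arrows_cycles[where n = n and D = D])
       (use E ND lenD le_n in \<open>simp_all add: b_def\<close>)
  then have "size_ramsey_cycles ns \<le> card E"
    unfolding size_ramsey_cycles_def using E(1) by (intro Least_le) blast
  then have "real (size_ramsey_cycles ns) \<le> bound" using E(2) q(2) by linarith
  then show "real (size_ramsey_cycles ns)
                 \<le> (ln (c_const ns) + 1) * (c_const ns)^2 * real (Max (set ns))"
    unfolding bound_def c_def n_def .
qed

end
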